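(* Fix an integer $n\ge2$. The cyclic Tamari lattice $\mathsf{CTam}_{312}$ is a sublattice of the cyclic Dyer lattice $\mathsf{CDyer}$; that is, the meet and the join in $\mathsf{CDyer}$ of elements of $\mathsf{CTam}_{312}$ belong to $\mathsf{CTam}_{312}$.
   Context: Fix an integer $n\ge 2$. A translation-invariant total order (TITO) is a total order $\preceq$ on $\mathbb Z$ such that for all $a,b\in\mathbb Z$, $a\preceq b$ iff $a+n\preceq b+n$. A reflection index is a pair $(a,b)$ of integers with $a<b$, considered up to simultaneous translation by multiples of $n$. An inversion of $\preceq$ is a reflection index $(a,b)$ with $b\preceq a$; $\mathrm{Inv}(\preceq)$ is the set of inversions. The cyclic Dyer lattice $\mathsf{CDyer}$ is the set of all TITOs ordered by $\preceq_1\,\le\,\preceq_2$ iff $\mathrm{Inv}(\preceq_1)\subseteq\mathrm{Inv}(\preceq_2)$; it is known to be a complete lattice. A TITO is $312$-avoiding if there are no integers $a<b<c$ with $c\preceq a\preceq b$. $\mathsf{CTam}_{312}$ is the subposet of $\mathsf{CDyer}$ consisting of $312$-avoiding TITOs. *)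

theory Defs
  imports "HOL-Algebra.Lattice"
begin

definition TITO :: "int \<Rightarrow> int rel \<Rightarrow> bool" where
  "TITO n r \<longleftrightarrow> linear_order r \<and> (\<forall>a b. (a, b) \<in> r \<longleftrightarrow> (a + n, b + n) \<in> r)"

definition translation :: "int \<Rightarrow> (int \<times> int) rel" where
  "translation n = {((a, b), (a + k * n, b + k * n)) | a b k. a < b}"

definition reflection_indices :: "int \<Rightarrow> (int \<times> int) set set" where
  "reflection_indices n = {(a, b). a < b} // translation n"

text \<open>For a TITO, being inverted does not depend on the representative of the
  translation class, so one inverted representative is enough.\<close>

definition inversions :: "int \<Rightarrow> int rel \<Rightarrow> (int \<times> int) set set" where
  "inversions n r = {C \<in> reflection_indices n. \<exists>(a, b)\<in>C. (b, a) \<in> r}"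

definition CDyer :: "int \<Rightarrow> int rel gorder" where
  "CDyer n =
    \<lparr>carrier = {r. TITO n r}, eq = (=), le = (\<lambda>r s. inversions n r \<subseteq> inversions n s)\<rparr>"

definition avoids_312 :: "int rel \<Rightarrow> bool" where
  "avoids_312 r \<longleftrightarrow> \<not> (\<exists>a b c. a < b \<and> b < c \<and> (c, a) \<in> r \<and> (a, b) \<in> r)"

definition CTam312 :: "int \<Rightarrow> int rel gorder" where
  "CTam312 n = CDyer n\<lparr>carrier := {r \<in> carrier (CDyer n). avoids_312 r}\<rparr>"

text \<open>Requiring \<open>lattice L\<close> guarantees that the choice-based \<open>\<squnion>\<close> and \<open>\<sqinter>\<close> are genuine
  least upper and greatest lower bounds in \<open>L\<close>.\<close>

definition sublattice :: "'a gorder \<Rightarrow> 'a set \<Rightarrow> bool" where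
  "sublattice L S \<longleftrightarrow> lattice L \<and> S \<subseteq> carrier L \<and>
    (\<forall>x\<in>S. \<forall>y\<in>S. x \<sqinter>\<^bsub>L\<^esub> y \<in> S \<and> x \<squnion>\<^bsub>L\<^esub> y \<in> S)"

end

theory Submission
  imports Defs
begin

text \<open>
  A total order on the integers is determined by its set \<open>I\<close> of inverted pairs \<open>a < b\<close>, and the
  sets that occur are exactly those for which both \<open>I\<close> and its complement in \<open>{(a, b). a < b}\<close>
  are transitive. Transitivity of the complement says that whenever \<open>a < b < c\<close> and
  \<open>(a, c) \<in> I\<close>, one of \<open>(a, b)\<close> and \<open>(b, c)\<close> lies in \<open>I\<close>; in this form the property is visibly
  inherited by unions. It also passes to transitive closures: a chain of steps
  from \<open>a\<close> to \<open>c\<close> either visits \<open>b\<close> or has a step that jumps over \<open>b\<close>, and then the property of that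
  single step lets the chain be cut at \<open>b\<close> (\<open>splitting_trancl\<close>). Hence \<open>(I \<union> J)\<^sup>+\<close> is again
  the inversion set of a total order, and this order is the join. Reversing an order complements
  its inversion set, so reversal turns joins into meets and the Dyer poset is a lattice.

  Avoiding 312 means that \<open>(a, c) \<in> I\<close> implies \<open>(a, b) \<in> I\<close> for \<open>a < b < c\<close>. Cutting chains as
  above shows that \<open>(I \<union> J)\<^sup>+\<close> inherits this (\<open>left_closed_trancl\<close>), which settles joins. For
  meets, the reversed orders satisfy the condition that \<open>(a, b) \<in> I\<close> implies
  \<open>(a, c) \<in> I\<close>, and \<open>(I \<union> J)\<^sup>+\<close> inherits this one too, because only the last step of a chain
  has to be lengthened (\<open>right_closed_trancl\<close>).
\<close>

section \<open>Inversion sets of total orders\<close>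

definition inversion_pairs :: "'a::linorder rel \<Rightarrow> 'a rel" where
  "inversion_pairs r = {(a, b). a < b \<and> (b, a) \<in> r}"

text \<open>The only candidate for a total order with inversion set \<open>I\<close>.\<close>

definition order_of_inversions :: "'a::linorder rel \<Rightarrow> 'a rel" where
  "order_of_inversions I = {(a, b). a = b \<or> (a < b \<and> (a, b) \<notin> I) \<or> (b < a \<and> (b, a) \<in> I)}"

text \<open>Transitivity of the complement of \<open>I\<close> in \<open>{(a, b). a < b}\<close>, written so that it mentions
  only members of \<open>I\<close>.\<close>

definition splitting :: "'a::linorder rel \<Rightarrow> bool" where
  "splitting I \<longleftrightarrow> (\<forall>a b c. a < b \<longrightarrow> b < c \<longrightarrow> (a, c) \<in> I \<longrightarrow> (a, b) \<in> I \<or> (b, c) \<in> I)"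

lemma linear_orderD:
  assumes "linear_order r"
  shows "(a, a) \<in> r"
    and "(a, b) \<in> r \<Longrightarrow> (b, c) \<in> r \<Longrightarrow> (a, c) \<in> r"
    and "(a, b) \<in> r \<Longrightarrow> (b, a) \<in> r \<Longrightarrow> a = b"
    and "(a, b) \<in> r \<or> (b, a) \<in> r"
proof -
  have r: "refl r" "trans r" "antisym r" "total r"
    using assms by (auto simp: linear_order_on_def partial_order_on_def preorder_on_def)
  show refl: "(a, a) \<in> r" using r(1) by (simp add: refl_on_def)
  show "(a, b) \<in> r \<Longrightarrow> (b, c) \<in> r \<Longrightarrow> (a, c) \<in> r" using r(2) by (meson transD)
  show "(a, b) \<in> r \<Longrightarrow> (b, a) \<in> r \<Longrightarrow> a = b" using r(3) by (meson antisymD)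
  show "(a, b) \<in> r \<or> (b, a) \<in> r" using r(4) refl by (cases "a = b") (auto simp: total_on_def)
qed

lemma inversion_pairs_less: "(a, b) \<in> inversion_pairs r \<Longrightarrow> a < b"
  by (simp add: inversion_pairs_def)

lemma trans_inversion_pairs:
  assumes "linear_order r"
  shows "trans (inversion_pairs r)"
proof (rule transI)
  fix a b c
  assume "(a, b) \<in> inversion_pairs r" "(b, c) \<in> inversion_pairs r"
  then show "(a, c) \<in> inversion_pairs r"
    using linear_orderD(2)[OF assms, of c b a] by (auto simp: inversion_pairs_def)
qed

lemma splitting_inversion_pairs:
  assumes "linear_order r"
  shows "splitting (inversion_pairs r)"
proof -
  have "(b, a) \<in> r \<or> (c, b) \<in> r" if "(c, a) \<in> r" for a b c
    using linear_orderD(2)[OF assms, of b c a] linear_orderD(4)[OF assms, of b c] that by blast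
  then show ?thesis
    unfolding splitting_def inversion_pairs_def by auto
qed

lemma order_of_inversion_pairs:
  assumes "linear_order r"
  shows "order_of_inversions (inversion_pairs r) = r"
proof -
  have "(a, b) \<in> order_of_inversions (inversion_pairs r) \<longleftrightarrow> (a, b) \<in> r" for a b
    using linear_orderD(1)[OF assms, of a] linear_orderD(3,4)[OF assms, of a b]
    by (cases a b rule: linorder_cases) (auto simp: order_of_inversions_def inversion_pairs_def)
  then show ?thesis by auto
qed

lemma inversion_pairs_order_of:
  assumes "\<And>a b. (a, b) \<in> I \<Longrightarrow> a < b"
  shows "inversion_pairs (order_of_inversions I) = I"
  using assms by (auto simp: order_of_inversions_def inversion_pairs_def)

text \<open>Each of the six relative positions of three distinct elements uses one instance of either
  the transitivity of \<open>I\<close> or that of its complement.\<close>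

lemma linear_order_of_inversions:
  assumes less: "\<And>a b. (a, b) \<in> I \<Longrightarrow> a < b" and "trans I" and "splitting I"
  shows "linear_order (order_of_inversions I)"
proof -
  let ?r = "order_of_inversions I"
  have tr: "(a, b) \<in> I \<Longrightarrow> (b, c) \<in> I \<Longrightarrow> (a, c) \<in> I" for a b c
    using \<open>trans I\<close> by (meson transD)
  have sp: "a < b \<Longrightarrow> b < c \<Longrightarrow> (a, c) \<in> I \<Longrightarrow> (a, b) \<in> I \<or> (b, c) \<in> I" for a b c
    using \<open>splitting I\<close> by (auto simp: splitting_def)
  have lt: "(a, b) \<in> ?r \<longleftrightarrow> (a, b) \<notin> I" and gt: "(b, a) \<in> ?r \<longleftrightarrow> (a, b) \<in> I" if "a < b" for a b
    using that by (auto simp: order_of_inversions_def)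
  have "trans ?r"
  proof (rule transI)
    fix a b c
    assume ab: "(a, b) \<in> ?r" and bc: "(b, c) \<in> ?r"
    consider "a = b \<or> b = c \<or> a = c" | "a < b" "b < c" | "a < c" "c < b" | "b < a" "a < c"
      | "b < c" "c < a" | "c < a" "a < b" | "c < b" "b < a"
      using linorder_less_linear[of a b] linorder_less_linear[of b c] linorder_less_linear[of a c]
      by blast
    then show "(a, c) \<in> ?r"
    proof cases
      case 1
      then show ?thesis using ab bc by (auto simp: order_of_inversions_def)
    next
      case 2
      then have "a < c" by order
      then show ?thesis using 2 ab bc sp[of a b c] by (simp add: lt) blast
    next
      case 3
      then have "a < b" by order
      then show ?thesis using 3 ab bc tr[of a c b] by (simp add: lt gt) blast
    next
      case 4
      then have "b < c" by order
      then show ?thesis using 4 ab bc tr[of b a c] by (simp add: lt gt) blast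
    next
      case 5
      then have "b < a" by order
      then show ?thesis using 5 ab bc sp[of b c a] by (simp add: lt gt)
    next
      case 6
      then have "c < b" by order
      then show ?thesis using 6 ab bc sp[of c a b] by (simp add: lt gt)
    next
      case 7
      then have "c < a" by order
      then show ?thesis using 7 ab bc tr[of c b a] by (simp add: gt)
    qed
  qed
  moreover have "antisym ?r"
    by (rule antisymI) (auto simp: order_of_inversions_def dest: less)
  moreover have "total ?r" "refl ?r"
    by (auto simp: order_of_inversions_def total_on_def refl_on_def)
  ultimately show ?thesis
    by (simp add: linear_order_on_def partial_order_on_def preorder_on_def)
qed

lemma linear_order_converse: "linear_order r \<Longrightarrow> linear_order (r\<inverse>)"
  by simp

lemma inversion_pairs_converse:
  assumes "linear_order r"
  shows "inversion_pairs (r\<inverse>) = {(a, b). a < b} - inversion_pairs r"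
proof -
  have "(a, b) \<in> r \<longleftrightarrow> (b, a) \<notin> r" if "a < b" for a b
    using linear_orderD(3,4)[OF assms, of a b] that by auto
  then show ?thesis by (auto simp: inversion_pairs_def)
qed

section \<open>Transitive closures\<close>

lemma trancl_less:
  assumes "\<And>a b. (a, b) \<in> I \<Longrightarrow> a < (b::'a::linorder)" and "(a, b) \<in> I\<^sup>+"
  shows "a < b"
  using assms(2) by induction (use assms(1) in force)+

lemma splitting_Un: "splitting I \<Longrightarrow> splitting J \<Longrightarrow> splitting (I \<union> J)"
  unfolding splitting_def by blast

text \<open>The induction runs along a chain from \<open>a\<close> to \<open>c\<close>: the step that reaches or passes \<open>b\<close> is
  the place where the chain is cut.\<close>

lemma splitting_trancl:
  assumes "splitting I"
  shows "splitting (I\<^sup>+)"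
proof -
  have "a < b \<Longrightarrow> b < c \<Longrightarrow> (a, b) \<in> I\<^sup>+ \<or> (b, c) \<in> I\<^sup>+" if "(a, c) \<in> I\<^sup>+" for a b c
    using that
  proof (induction arbitrary: b rule: trancl_induct)
    case (base y)
    then show ?case using assms unfolding splitting_def by blast
  next
    case (step y z)
    consider "b < y" | "b = y" | "y < b" by fastforce
    then show ?case
    proof cases
      case 1
      then show ?thesis using step by (meson trancl.trancl_into_trancl)
    next
      case 2
      then show ?thesis using step by simp
    next
      case 3
      then have "(y, b) \<in> I \<or> (b, z) \<in> I" using step assms by (simp add: splitting_def)
      then show ?thesis using step by (meson r_into_trancl trancl.trancl_into_trancl)
    qed
  qed
  then show ?thesis by (simp add: splitting_def)
qed

definition left_closed :: "'a::linorder rel \<Rightarrow> bool" where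
  "left_closed I \<longleftrightarrow> (\<forall>a b c. a < b \<longrightarrow> b < c \<longrightarrow> (a, c) \<in> I \<longrightarrow> (a, b) \<in> I)"

definition right_closed :: "'a::linorder rel \<Rightarrow> bool" where
  "right_closed I \<longleftrightarrow> (\<forall>a b c. a < b \<longrightarrow> b < c \<longrightarrow> (a, b) \<in> I \<longrightarrow> (a, c) \<in> I)"

text \<open>In a chain from \<open>a\<close> to \<open>c\<close>, the step that passes \<open>b\<close> can be shortened so that it ends at
  \<open>b\<close>.\<close>

lemma left_closed_trancl:
  assumes "left_closed I"
  shows "left_closed (I\<^sup>+)"
proof -
  have "a < b \<Longrightarrow> b < c \<Longrightarrow> (a, b) \<in> I\<^sup>+" if "(a, c) \<in> I\<^sup>+" for a b c
    using that
  proof (induction arbitrary: b rule: trancl_induct)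
    case (base y)
    then show ?case using assms unfolding left_closed_def by blast
  next
    case (step y z)
    consider "b < y" | "b = y" | "y < b" by fastforce
    then show ?case
    proof cases
      case 3
      then have "(y, b) \<in> I" using step assms unfolding left_closed_def by blast
      then show ?thesis using step by (meson trancl.trancl_into_trancl)
    qed (use step in auto)
  qed
  then show ?thesis by (auto simp: left_closed_def)
qed

text \<open>Only the last step of a chain from \<open>a\<close> to \<open>b\<close> is redirected to \<open>c\<close>. Since \<open>I\<close> increases, the
  start of that step lies below \<open>b\<close>, as right closure demands.\<close>

lemma right_closed_trancl:
  assumes less: "\<And>a b. (a, b) \<in> I \<Longrightarrow> a < b" and "right_closed I"
  shows "right_closed (I\<^sup>+)"
proof -
  have "(a, c) \<in> I\<^sup>+" if "(a, b) \<in> I\<^sup>+" "b < c" for a b c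
    using that(1)
  proof cases
    case base
    then show ?thesis using assms that(2) unfolding right_closed_def by blast
  next
    case (step y)
    then have "(y, c) \<in> I" using assms that(2) unfolding right_closed_def by blast
    then show ?thesis using step(1) by (rule trancl_into_trancl[rotated])
  qed
  then show ?thesis by (auto simp: right_closed_def)
qed

lemma left_closed_Un: "left_closed I \<Longrightarrow> left_closed J \<Longrightarrow> left_closed (I \<union> J)"
  unfolding left_closed_def by blast

lemma right_closed_Un: "right_closed I \<Longrightarrow> right_closed J \<Longrightarrow> right_closed (I \<union> J)"
  unfolding right_closed_def by blast

text \<open>A pattern 312 consists of \<open>a < b < c\<close> such that \<open>(a, c)\<close> is inverted and \<open>(a, b)\<close> is
  not.\<close>

lemma avoids_312_iff_left_closed:
  assumes "linear_order r"
  shows "avoids_312 r \<longleftrightarrow> left_closed (inversion_pairs r)"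
proof -
  have "(a, b) \<in> r \<longleftrightarrow> (b, a) \<notin> r" if "a < b" for a b
    using linear_orderD(3,4)[OF assms, of a b] that by auto
  then show ?thesis
    unfolding avoids_312_def left_closed_def inversion_pairs_def
    by (auto dest: order.strict_trans)
qed

text \<open>Reversing the order complements the inversion set, and right closure of the complement is
  the contrapositive of left closure. This lets statements about joins be applied to meets.\<close>

lemma avoids_312_iff_right_closed_converse:
  assumes "linear_order r"
  shows "avoids_312 r \<longleftrightarrow> right_closed (inversion_pairs (r\<inverse>))"
  unfolding avoids_312_iff_left_closed[OF assms] inversion_pairs_converse[OF assms]
    left_closed_def right_closed_def
  by (auto dest: order.strict_trans)

section \<open>Translation-invariant orders\<close>

lemma TITO_linear_order: "TITO n r \<Longrightarrow> linear_order r"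
  by (simp add: TITO_def)

lemma TITO_converse: "TITO n r \<Longrightarrow> TITO n (r\<inverse>)"
  unfolding TITO_def converse_iff by (blast intro: linear_order_converse)

lemma TITO_translate:
  assumes "TITO n r"
  shows "(a + k * n, b + k * n) \<in> r \<longleftrightarrow> (a, b) \<in> r"
proof (induction k rule: int_induct[where k = 0])
  case base
  show ?case by simp
next
  case (step1 i)
  have "(a + i * n, b + i * n) \<in> r \<longleftrightarrow> (a + i * n + n, b + i * n + n) \<in> r"
    using assms by (simp add: TITO_def)
  then show ?case using step1 by (simp add: algebra_simps)
next
  case (step2 i)
  have "(a + (i - 1) * n, b + (i - 1) * n) \<in> r
      \<longleftrightarrow> (a + (i - 1) * n + n, b + (i - 1) * n + n) \<in> r"
    using assms by (simp add: TITO_def)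
  then show ?case using step2 by (simp add: algebra_simps)
qed

text \<open>Because of translation invariance, comparing classes of inverted pairs amounts to comparing
  the pairs themselves.\<close>

lemma inversions_subset_iff:
  assumes r: "TITO n r" and s: "TITO n s"
  shows "inversions n r \<subseteq> inversions n s \<longleftrightarrow> inversion_pairs r \<subseteq> inversion_pairs s"
proof
  assume sub: "inversions n r \<subseteq> inversions n s"
  show "inversion_pairs r \<subseteq> inversion_pairs s"
  proof clarify
    fix a b
    assume "(a, b) \<in> inversion_pairs r"
    then have ab: "a < b" "(b, a) \<in> r" by (auto simp: inversion_pairs_def)
    let ?C = "translation n `` {(a, b)}"
    have "(a + 0 * n, b + 0 * n) \<in> ?C"
      using ab(1) unfolding translation_def by blast
    then have "(a, b) \<in> ?C" by simp
    moreover have "?C \<in> reflection_indices n"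
      using ab(1) by (auto simp: reflection_indices_def intro: quotientI)
    ultimately have "?C \<in> inversions n r"
      using ab(2) by (auto simp: inversions_def)
    then have "?C \<in> inversions n s" using sub by blast
    then obtain k where "(b + k * n, a + k * n) \<in> s"
      by (auto simp: inversions_def translation_def)
    then show "(a, b) \<in> inversion_pairs s"
      using ab(1) by (simp add: inversion_pairs_def TITO_translate[OF s])
  qed
next
  assume sub: "inversion_pairs r \<subseteq> inversion_pairs s"
  show "inversions n r \<subseteq> inversions n s"
  proof
    fix C
    assume "C \<in> inversions n r"
    then obtain a b where C: "C \<in> reflection_indices n" "(a, b) \<in> C" "(b, a) \<in> r"
      by (auto simp: inversions_def)
    then have "a < b"
      by (auto simp: reflection_indices_def quotient_def translation_def)
    then have "(b, a) \<in> s" using C(3) sub by (auto simp: inversion_pairs_def)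
    then show "C \<in> inversions n s" using C by (auto simp: inversions_def)
  qed
qed

text \<open>The shift \<open>m\<close> is arbitrary so that the lemma serves for translations by \<open>n\<close> and by \<open>- n\<close>,
  which together give an equivalence.\<close>

lemma trancl_translate:
  assumes "\<And>a b. (a, b) \<in> I \<Longrightarrow> (a + m, b + m) \<in> I" and "(a, b) \<in> I\<^sup>+"
  shows "(a + m, b + m) \<in> I\<^sup>+"
  using assms(2) by induction (auto intro: assms(1) trancl.trancl_into_trancl)

definition dyer_join :: "'a::linorder rel \<Rightarrow> 'a rel \<Rightarrow> 'a rel" where
  "dyer_join r s = order_of_inversions ((inversion_pairs r \<union> inversion_pairs s)\<^sup>+)"

text \<open>Reversal is an anti-automorphism of the Dyer order.\<close>

definition dyer_meet :: "'a::linorder rel \<Rightarrow> 'a rel \<Rightarrow> 'a rel" where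
  "dyer_meet r s = (dyer_join (r\<inverse>) (s\<inverse>))\<inverse>"

lemma inversion_pairs_join:
  "inversion_pairs (dyer_join r s) = (inversion_pairs r \<union> inversion_pairs s)\<^sup>+"
  unfolding dyer_join_def
  by (rule inversion_pairs_order_of, erule trancl_less[rotated]) (auto dest: inversion_pairs_less)

lemma linear_order_join:
  assumes "linear_order r" "linear_order s"
  shows "linear_order (dyer_join r s)"
  unfolding dyer_join_def
proof (rule linear_order_of_inversions)
  let ?I = "inversion_pairs r \<union> inversion_pairs s"
  show "a < b" if "(a, b) \<in> ?I\<^sup>+" for a b
    using that by (rule trancl_less[rotated]) (auto dest: inversion_pairs_less)
  show "trans (?I\<^sup>+)" by simp
  show "splitting (?I\<^sup>+)"
    using assms by (intro splitting_trancl splitting_Un splitting_inversion_pairs)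
qed

lemma TITO_join:
  assumes r: "TITO n r" and s: "TITO n s"
  shows "TITO n (dyer_join r s)"
proof -
  let ?I = "inversion_pairs r \<union> inversion_pairs s"
  have I: "(a, b) \<in> ?I \<Longrightarrow> (a + k * n, b + k * n) \<in> ?I" for a b k
    using TITO_translate[OF r, of b k a] TITO_translate[OF s, of b k a]
    by (auto simp: inversion_pairs_def)
  have up: "(a, b) \<in> ?I\<^sup>+ \<Longrightarrow> (a + n, b + n) \<in> ?I\<^sup>+" for a b
    by (rule trancl_translate) (use I[where k = 1] in simp)
  have down: "(a + n, b + n) \<in> ?I\<^sup>+ \<Longrightarrow> (a, b) \<in> ?I\<^sup>+" for a b
    using trancl_translate[where m = "- n" and I = ?I and a = "a + n" and b = "b + n"]
      I[where k = "-1"] by simp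
  have "(a + n, b + n) \<in> ?I\<^sup>+ \<longleftrightarrow> (a, b) \<in> ?I\<^sup>+" for a b
    using up down by blast
  then have "\<forall>a b. (a, b) \<in> dyer_join r s \<longleftrightarrow> (a + n, b + n) \<in> dyer_join r s"
    by (simp add: dyer_join_def order_of_inversions_def)
  then show ?thesis
    using linear_order_join[OF TITO_linear_order[OF r] TITO_linear_order[OF s]]
    by (simp add: TITO_def)
qed

lemma TITO_meet: "TITO n r \<Longrightarrow> TITO n s \<Longrightarrow> TITO n (dyer_meet r s)"
  by (simp add: dyer_meet_def TITO_join TITO_converse)

lemma avoids_312_join:
  assumes "linear_order r" "linear_order s" "avoids_312 r" "avoids_312 s"
  shows "avoids_312 (dyer_join r s)"
  using assms
  by (simp add: avoids_312_iff_left_closed linear_order_join inversion_pairs_join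
      left_closed_trancl left_closed_Un)

lemma avoids_312_meet:
  assumes "linear_order r" "linear_order s" "avoids_312 r" "avoids_312 s"
  shows "avoids_312 (dyer_meet r s)"
proof -
  have "right_closed ((inversion_pairs (r\<inverse>) \<union> inversion_pairs (s\<inverse>))\<^sup>+)"
    by (rule right_closed_trancl)
      (use assms in \<open>auto simp: avoids_312_iff_right_closed_converse
        intro: right_closed_Un dest: inversion_pairs_less\<close>)
  then show ?thesis
    using assms
    by (simp add: avoids_312_iff_right_closed_converse dyer_meet_def linear_order_join
        inversion_pairs_join)
qed

section \<open>The Dyer lattice\<close>

lemma carrier_CDyer [simp]: "r \<in> carrier (CDyer n) \<longleftrightarrow> TITO n r"
  by (simp add: CDyer_def)

lemma eq_CDyer [simp]: "r .=\<^bsub>CDyer n\<^esub> s \<longleftrightarrow> r = s"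
  by (simp add: CDyer_def)

lemma le_CDyer:
  assumes "TITO n r" "TITO n s"
  shows "r \<sqsubseteq>\<^bsub>CDyer n\<^esub> s \<longleftrightarrow> inversion_pairs r \<subseteq> inversion_pairs s"
  using inversions_subset_iff[OF assms] by (simp add: CDyer_def)

lemma le_CDyer_converse:
  assumes "TITO n r" "TITO n s"
  shows "r\<inverse> \<sqsubseteq>\<^bsub>CDyer n\<^esub> s\<inverse> \<longleftrightarrow> s \<sqsubseteq>\<^bsub>CDyer n\<^esub> r"
  using assms
  by (auto simp: le_CDyer TITO_converse inversion_pairs_converse TITO_linear_order
      dest: inversion_pairs_less)

lemma partial_order_CDyer: "partial_order (CDyer n)"
proof -
  have antisym: "r = s"
    if "TITO n r" "TITO n s" "r \<sqsubseteq>\<^bsub>CDyer n\<^esub> s" "s \<sqsubseteq>\<^bsub>CDyer n\<^esub> r" for r s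
  proof -
    have "inversion_pairs r = inversion_pairs s" using that by (simp add: le_CDyer)
    then show ?thesis
      using that(1,2) by (metis TITO_linear_order order_of_inversion_pairs)
  qed
  show ?thesis
    by unfold_locales (use antisym in \<open>auto simp: CDyer_def\<close>)
qed

lemma join_upper:
  assumes "TITO n r" "TITO n s"
  shows "r \<sqsubseteq>\<^bsub>CDyer n\<^esub> dyer_join r s" "s \<sqsubseteq>\<^bsub>CDyer n\<^esub> dyer_join r s"
  using assms by (auto simp: le_CDyer TITO_join inversion_pairs_join)

text \<open>The inversion set of an upper bound is transitive, so with the two given inversion sets it
  contains the transitive closure of their union.\<close>

lemma join_least:
  assumes "TITO n r" "TITO n s" "TITO n u" "r \<sqsubseteq>\<^bsub>CDyer n\<^esub> u" "s \<sqsubseteq>\<^bsub>CDyer n\<^esub> u"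
  shows "dyer_join r s \<sqsubseteq>\<^bsub>CDyer n\<^esub> u"
proof -
  have "inversion_pairs r \<union> inversion_pairs s \<subseteq> inversion_pairs u"
    using assms by (simp add: le_CDyer)
  then have "(inversion_pairs r \<union> inversion_pairs s)\<^sup>+ \<subseteq> (inversion_pairs u)\<^sup>+"
    by (auto intro: trancl_mono)
  also have "\<dots> = inversion_pairs u"
    using assms by (simp add: trancl_id trans_inversion_pairs TITO_linear_order)
  finally show ?thesis
    using assms by (simp add: le_CDyer TITO_join inversion_pairs_join)
qed

lemma least_join:
  assumes "TITO n r" "TITO n s"
  shows "least (CDyer n) (dyer_join r s) (Upper (CDyer n) {r, s})"
  using assms TITO_join[OF assms] join_upper[OF assms] join_least[OF assms]
  by (simp add: least_def Upper_def)

lemma greatest_meet: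
  assumes "TITO n r" "TITO n s"
  shows "greatest (CDyer n) (dyer_meet r s) (Lower (CDyer n) {r, s})"
proof -
  note conv = assms[THEN TITO_converse]
  have meet: "TITO n (dyer_meet r s)" using assms by (rule TITO_meet)
  have le: "dyer_meet r s \<sqsubseteq>\<^bsub>CDyer n\<^esub> u" if "TITO n u" "u\<inverse> \<sqsubseteq>\<^bsub>CDyer n\<^esub> dyer_join (r\<inverse>) (s\<inverse>)" for u
    using le_CDyer_converse[OF that(1) meet] that(2) by (simp add: dyer_meet_def)
  have lower: "dyer_meet r s \<sqsubseteq>\<^bsub>CDyer n\<^esub> r" "dyer_meet r s \<sqsubseteq>\<^bsub>CDyer n\<^esub> s"
    using assms join_upper[OF conv] by (blast intro: le)+
  have greatest: "u \<sqsubseteq>\<^bsub>CDyer n\<^esub> dyer_meet r s"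
    if u: "TITO n u" "u \<sqsubseteq>\<^bsub>CDyer n\<^esub> r" "u \<sqsubseteq>\<^bsub>CDyer n\<^esub> s" for u
  proof -
    have "r\<inverse> \<sqsubseteq>\<^bsub>CDyer n\<^esub> u\<inverse>" "s\<inverse> \<sqsubseteq>\<^bsub>CDyer n\<^esub> u\<inverse>"
      using u le_CDyer_converse assms by blast+
    then have "dyer_join (r\<inverse>) (s\<inverse>) \<sqsubseteq>\<^bsub>CDyer n\<^esub> u\<inverse>"
      using conv TITO_converse[OF u(1)] by (intro join_least)
    then show ?thesis
      using le_CDyer_converse[OF meet u(1)] by (simp add: dyer_meet_def)
  qed
  show ?thesis
    using assms meet lower greatest by (auto simp: greatest_def Lower_def)
qed

lemma lattice_CDyer: "lattice (CDyer n)"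
proof -
  interpret partial_order "CDyer n" by (rule partial_order_CDyer)
  show ?thesis
  proof unfold_locales
    fix r s
    assume "r \<in> carrier (CDyer n)" "s \<in> carrier (CDyer n)"
    then have "TITO n r" "TITO n s" by simp_all
    then show "\<exists>u. least (CDyer n) u (Upper (CDyer n) {r, s})"
      and "\<exists>u. greatest (CDyer n) u (Lower (CDyer n) {r, s})"
      using least_join greatest_meet by blast+
  qed
qed

lemma join_CDyer:
  assumes "TITO n r" "TITO n s"
  shows "r \<squnion>\<^bsub>CDyer n\<^esub> s = dyer_join r s"
proof -
  interpret partial_order "CDyer n" by (rule partial_order_CDyer)
  show ?thesis
    unfolding join_def sup_def
    by (intro some_equality least_join assms) (rule least_unique[OF _ least_join[OF assms]])
qed

lemma meet_CDyer:
  assumes "TITO n r" "TITO n s"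
  shows "r \<sqinter>\<^bsub>CDyer n\<^esub> s = dyer_meet r s"
proof -
  interpret partial_order "CDyer n" by (rule partial_order_CDyer)
  show ?thesis
    unfolding meet_def inf_def
    by (intro some_equality greatest_meet assms)
      (rule greatest_unique[OF _ greatest_meet[OF assms]])
qed

theorem theorem4p13:
  fixes n :: int
  assumes "n \<ge> 2"
  shows "sublattice (CDyer n) (carrier (CTam312 n))"
proof -
  have S: "r \<in> carrier (CTam312 n) \<longleftrightarrow> TITO n r \<and> avoids_312 r" for r
    by (simp add: CTam312_def)
  show ?thesis
    unfolding sublattice_def
  proof (intro conjI ballI subsetI)
    fix r s
    assume "r \<in> carrier (CTam312 n)" "s \<in> carrier (CTam312 n)"
    then have rs: "TITO n r" "TITO n s" "avoids_312 r" "avoids_312 s"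
      by (simp_all add: S)
    note lin = rs(1,2)[THEN TITO_linear_order]
    show "r \<sqinter>\<^bsub>CDyer n\<^esub> s \<in> carrier (CTam312 n)"
      using rs TITO_meet avoids_312_meet[OF lin] by (simp add: S meet_CDyer)
    show "r \<squnion>\<^bsub>CDyer n\<^esub> s \<in> carrier (CTam312 n)"
      using rs TITO_join avoids_312_join[OF lin] by (simp add: S join_CDyer)
  qed (use lattice_CDyer S in auto)
qed

end
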